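(* Let $0<q<1$, let $x,y,z\in\mathbb{C}$ with $|x|,|y|,|z|<1$, and let $\alpha_1,\alpha_2,\beta_1,\beta_2\in\mathbb{C}$ and $\gamma_i,\eta_i,\lambda_i,\nu_i\in\mathbb{C}$ $(i=1,2,3)$ satisfy $\min\{\Re(\gamma_i+\eta_i-\lambda_i-\nu_i),\Re(\lambda_i),\Re(\nu_i)\}>0$ and $q^{\gamma_i},q^{\eta_i}\notin\{q^{-n}:n\in\mathbb{Z}_{\ge0}\}$ for $i=1,2,3$. Then \begin{align*} &\widetilde{\Phi}_K[\alpha_1,\alpha_2,\alpha_2,\beta_1,\beta_2,\beta_1;\gamma_1,\gamma_2,\gamma_3;q,x,y,z]\\ &=\int_{[0,1]^3}\Bigg(\sum_{m,n,p=0}^{\infty}(q^{\alpha_2};q)_{n+p}(q^{\beta_1};q)_{p+m}\frac{(q^{\alpha_1},q^{\eta_1};q)_m}{(q^{\nu_1},q^{\lambda_1},q;q)_m}\frac{(q^{\beta_2},q^{\eta_2};q)_n}{(q^{\nu_2},q^{\lambda_2},q;q)_n}\frac{(q^{\eta_3};q)_p}{(q^{\nu_3},q^{\lambda_3},q;q)_p}(xt_1)^m(yt_2)^n(zt_3)^p\Bigg)\\ &\qquad\cdot\prod_{j=1}^{3}\mathrm{d}\mu_{\eta_j-\lambda_j,\;\gamma_j-\lambda_j,\;\gamma_j-\lambda_j+\eta_j-\nu_j,\;\nu_j}(t_j;q). \end{align*}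
   Context: $(a;q)_n=\prod_{j=0}^{n-1}(1-aq^j)$, $(a;q)_\infty=\prod_{j\ge0}(1-aq^j)$, $(a_1,\dots,a_m;q)_n=(a_1;q)_n\cdots(a_m;q)_n$. The $k$-dimensional $q$-integral is $\int_{[0,1]^k}f(\mathbf{x})\,\mathrm{d}_q\mathbf{x}=(1-q)^k\sum_{n_1,\dots,n_k\ge0}f(q^{n_1},\dots,q^{n_k})q^{n_1+\cdots+n_k}$. $\Gamma_q(x)=\frac{(q;q)_\infty}{(q^x;q)_\infty}(1-q)^{1-x}$. The $q$-analogue of Saran's function $F_K$ is \[ \widetilde{\Phi}_K[\alpha_1,\alpha_2,\alpha_2,\beta_1,\beta_2,\beta_1;\gamma_1,\gamma_2,\gamma_3;q,x,y,z]=\sum_{m,n,p=0}^{\infty}\frac{(q^{\alpha_1};q)_m(q^{\alpha_2};q)_{n+p}(q^{\beta_1};q)_{m+p}(q^{\beta_2};q)_n}{(q^{\gamma_1},q;q)_m(q^{\gamma_2},q;q)_n(q^{\gamma_3},q;q)_p}x^my^nz^p\quad(|x|,|y|,|z|<1). \] The basic hypergeometric series is ${}_{r}\phi_{s}\left[\begin{matrix}a_1,\cdots,a_r\\ b_1,\cdots,b_s\end{matrix};q,z\right]=\sum_{n\ge0}\frac{(a_1,\cdots,a_r;q)_n}{(b_1,\cdots,b_s,q;q)_n}\big((-1)^nq^{\binom n2}\big)^{1+s-r}z^n$. The $q$-hypergeometric measure is, for $\min\{\Re(\eta),\Re(\gamma),\Re(\eta+\gamma-\alpha-\beta)\}>0$,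 \[ \mathrm{d}\mu_{\alpha,\beta,\gamma,\eta}(t;q)=\frac{\Gamma_q(\eta+\gamma-\alpha)\Gamma_q(\eta+\gamma-\beta)}{\Gamma_q(\eta)\Gamma_q(\gamma)\Gamma_q(\eta+\gamma-\alpha-\beta)}\,t^{\eta-1}\frac{(tq;q)_\infty}{(tq^{\gamma};q)_\infty}\,{}_{3}\phi_{1}\left[\begin{matrix}q^{\alpha},q^{\beta},t^{-1}\\ q^{\gamma}\end{matrix};q,tq^{\gamma-\alpha-\beta}\right]\mathrm{d}_qt \] (at the points $t=q^n$, $n\ge0$, the ${}_3\phi_1$ terminates). *)

theory Defs
  imports "HOL-Analysis.Analysis"
begin

definition qpoch :: "complex \<Rightarrow> real \<Rightarrow> nat \<Rightarrow> complex" where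
  "qpoch a q n = (\<Prod>j<n. 1 - a * of_real q ^ j)"

definition qpoch_inf :: "complex \<Rightarrow> real \<Rightarrow> complex" where
  "qpoch_inf a q = (\<Prod>j. 1 - a * of_real q ^ j)"

definition qpochs :: "complex list \<Rightarrow> real \<Rightarrow> nat \<Rightarrow> complex" where
  "qpochs as q n = (\<Prod>a\<leftarrow>as. qpoch a q n)"

definition qGamma :: "real \<Rightarrow> complex \<Rightarrow> complex" where
  "qGamma q x = qpoch_inf (of_real q) q / qpoch_inf (of_real q powr x) q * of_real (1 - q) powr (1 - x)"

text \<open>Points of \<open>[0,1]\<^sup>k\<close> are functions on the index set \<open>{1..k}\<close> (\<open>undefined\<close> elsewhere).
  The multiple series is an unordered (absolutely convergent) sum.\<close>

definition qintegral :: "real \<Rightarrow> nat \<Rightarrow> ((nat \<Rightarrow> real) \<Rightarrow> complex) \<Rightarrow> complex" where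
  "qintegral q k f = of_real (1 - q) ^ k *
     (\<Sum>\<^sub>\<infinity>n\<in>{1..k} \<rightarrow>\<^sub>E (UNIV :: nat set).
        f (\<lambda>i\<in>{1..k}. q ^ n i) * of_real q ^ (\<Sum>i=1..k. n i))"

definition basic_hypergeom :: "complex list \<Rightarrow> complex list \<Rightarrow> real \<Rightarrow> complex \<Rightarrow> complex" where
  "basic_hypergeom as bs q z =
     (\<Sum>n. qpochs as q n / qpochs (bs @ [of_real q]) q n *
        ((-1) ^ n * of_real q ^ (n choose 2)) powi (1 + int (length bs) - int (length as)) * z ^ n)"

text \<open>The density, with respect to \<open>d\<^sub>q t\<close>, of the \<open>q\<close>-hypergeometric measure.\<close>

definition qhyp_density ::
  "complex \<Rightarrow> complex \<Rightarrow> complex \<Rightarrow> complex \<Rightarrow> real \<Rightarrow> real \<Rightarrow> complex" where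
  "qhyp_density \<alpha> \<beta> \<gamma> \<eta> q t =
     qGamma q (\<eta> + \<gamma> - \<alpha>) * qGamma q (\<eta> + \<gamma> - \<beta>) /
       (qGamma q \<eta> * qGamma q \<gamma> * qGamma q (\<eta> + \<gamma> - \<alpha> - \<beta>)) *
     of_real t powr (\<eta> - 1) *
     (qpoch_inf (of_real (t * q)) q / qpoch_inf (of_real t * of_real q powr \<gamma>) q) *
     basic_hypergeom [of_real q powr \<alpha>, of_real q powr \<beta>, inverse (of_real t)] [of_real q powr \<gamma>] q
       (of_real t * of_real q powr (\<gamma> - \<alpha> - \<beta>))"

text \<open>In the usual notation for Saran's function the parameters read
  \<open>[\<alpha>1, \<alpha>2, \<alpha>2, \<beta>1, \<beta>2, \<beta>1; \<gamma>1, \<gamma>2, \<gamma>3; q, x, y, z]\<close>;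
  the repeated ones are passed once.\<close>

definition Phi_K :: "complex \<Rightarrow> complex \<Rightarrow> complex \<Rightarrow> complex \<Rightarrow> complex \<Rightarrow> complex \<Rightarrow> complex \<Rightarrow>
    real \<Rightarrow> complex \<Rightarrow> complex \<Rightarrow> complex \<Rightarrow> complex" where
  "Phi_K \<alpha>1 \<alpha>2 \<beta>1 \<beta>2 \<gamma>1 \<gamma>2 \<gamma>3 q x y z =
     (\<Sum>\<^sub>\<infinity>(m, n, p)\<in>UNIV.
        qpoch (of_real q powr \<alpha>1) q m * qpoch (of_real q powr \<alpha>2) q (n + p) *
        qpoch (of_real q powr \<beta>1) q (m + p) * qpoch (of_real q powr \<beta>2) q n /
        (qpochs [of_real q powr \<gamma>1, of_real q] q m *
         qpochs [of_real q powr \<gamma>2, of_real q] q n *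
         qpochs [of_real q powr \<gamma>3, of_real q] q p) *
        x ^ m * y ^ n * z ^ p)"

end

theory Submission
  imports Defs
begin

text \<open>At \<open>t = q\<^sup>n\<close> the \<open>\<^sub>3\<phi>\<^sub>1\<close> in the \<open>q\<close>-hypergeometric measure is a finite sum over \<open>k \<le> n\<close>.
  Summing over \<open>n = k + j\<close> first in \<open>j\<close> by the \<open>q\<close>-binomial theorem and then in \<open>k\<close> by the
  \<open>q\<close>-Gauss sum evaluates all moments: the \<open>m\<close>-th moment of the measure with parameters
  \<open>\<eta> - \<lambda>, \<gamma> - \<lambda>, \<gamma> - \<lambda> + \<eta> - \<nu>, \<nu>\<close> is
  \<open>(q\<^sup>\<nu>, q\<^sup>\<lambda>; q)\<^sub>m / (q\<^sup>\<gamma>, q\<^sup>\<eta>; q)\<^sub>m\<close>.  Since shifted factorials and their reciprocals are bounded,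
  the triple series may be integrated term by term, and each moment turns the coefficients of the
  integrand into those of \<open>\<Phi>\<^sub>K\<close>.\<close>

section \<open>Products and comparison of absolutely convergent complex families\<close>

text \<open>For complex families unconditional and absolute summability coincide, so the norms of
  the products are summable over the rectangle, and the value can be read off from the iterated
  sums.\<close>

lemma has_sum_Times:
  fixes f g :: "_ \<Rightarrow> complex"
  assumes f: "(f has_sum a) A" and g: "(g has_sum b) B"
  shows "((\<lambda>(x, y). f x * g y) has_sum (a * b)) (A \<times> B)"
proof (rule has_sum_SigmaI)
  show "((\<lambda>y. case (x, y) of (x, y) \<Rightarrow> f x * g y) has_sum (f x * b)) B" for x
    using has_sum_cmult_right[OF g] by simp
  show "((\<lambda>x. f x * b) has_sum (a * b)) A"
    by (rule has_sum_cmult_left[OF f])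
  have "(\<lambda>x. norm (f x)) summable_on A" "(\<lambda>x. norm (g x)) summable_on B"
    using f g by (auto simp flip: summable_on_iff_abs_summable_on_complex
        intro: has_sum_imp_summable)
  then have "(\<lambda>(x, y). norm (f x) * norm (g y)) summable_on A \<times> B"
    by (intro summable_on_SigmaI[where g = "\<lambda>x. norm (f x) * (\<Sum>\<^sub>\<infinity>y\<in>B. norm (g y))"])
       (auto intro!: has_sum_cmult_right summable_on_cmult_left)
  then show "(\<lambda>(x, y). f x * g y) summable_on A \<times> B"
    unfolding summable_on_iff_abs_summable_on_complex
    by (simp add: case_prod_unfold norm_mult)
qed

text \<open>The majorant may itself be complex, because summability of \<open>g\<close> already
  means absolute summability. Products built with \<open>has_sum_Times\<close> can thus serve as
  majorants directly.\<close>

lemma summable_on_comparison_complex: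
  fixes f :: "_ \<Rightarrow> complex"
  assumes "g summable_on A" "\<And>x. x \<in> A \<Longrightarrow> norm (f x) \<le> C * norm (g x :: complex)"
  shows "f summable_on A"
  unfolding summable_on_iff_abs_summable_on_complex
proof (rule Infinite_Sum.abs_summable_on_comparison_test')
  show "(\<lambda>x. C * norm (g x)) summable_on A"
    using assms(1) by (intro summable_on_cmult_right)
      (simp add: summable_on_iff_abs_summable_on_complex)
qed (rule assms(2))

lemma geometric_has_sum:
  assumes "norm (z :: complex) < 1"
  shows "((\<lambda>n. z ^ n) has_sum (1 / (1 - z))) UNIV"
  using assms
  by (intro norm_summable_imp_has_sum geometric_sums) (auto simp: norm_power summable_geometric)

section \<open>Finite and infinite q-shifted factorials\<close>

lemma qpoch_0 [simp]: "qpoch a q 0 = 1"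
  by (simp add: qpoch_def)

lemma qpoch_Suc: "qpoch a q (Suc n) = qpoch a q n * (1 - a * of_real q ^ n)"
  by (simp add: qpoch_def)

lemma qpoch_add: "qpoch a q (m + n) = qpoch a q m * qpoch (a * of_real q ^ m) q n"
  by (induction n) (simp_all add: qpoch_Suc power_add mult_ac)

lemma qpoch_nonzero:
  assumes "\<And>j. a * of_real q ^ j \<noteq> 1"
  shows "qpoch a q n \<noteq> 0"
  using assms by (auto simp: qpoch_def)

context
  fixes q :: real
  assumes q_pos: "0 < q" and q_less_1: "q < 1"
begin

lemma norm_q_power_le: "norm (of_real q ^ n :: complex) \<le> 1"
  using q_pos q_less_1 by (simp add: norm_power power_le_one)

lemma mult_q_power_neq_1:
  assumes "norm a < 1"
  shows "a * of_real q ^ j \<noteq> (1 :: complex)"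
proof
  assume "a * of_real q ^ j = 1"
  then have "1 = norm (a * of_real q ^ j)" by simp
  also have "\<dots> \<le> norm a * 1"
    unfolding norm_mult by (intro mult_left_mono norm_q_power_le) auto
  finally show False using assms by simp
qed

lemma norm_of_real_q_less_1: "norm (of_real q :: complex) < 1"
  using q_pos q_less_1 by simp

lemma convergent_prod_qpoch: "convergent_prod (\<lambda>j. 1 - a * of_real q ^ j :: complex)"
proof (intro abs_convergent_prod_imp_convergent_prod summable_imp_abs_convergent_prod)
  have "summable (\<lambda>j. norm a * norm (of_real q :: complex) ^ j)"
    using norm_of_real_q_less_1 by (intro summable_mult summable_geometric) simp
  then show "summable (\<lambda>i. norm (1 - a * of_real q ^ i - 1))"
    by (simp add: norm_mult norm_power)
qed

lemma qpoch_tendsto: "qpoch a q \<longlonglongrightarrow> qpoch_inf a q"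
  using convergent_prod_LIMSEQ[OF convergent_prod_qpoch]
  unfolding qpoch_inf_def qpoch_def[abs_def] LIMSEQ_lessThan_iff_atMost .

lemma qpoch_inf_nonzero:
  assumes "\<And>j. a * of_real q ^ j \<noteq> 1"
  shows "qpoch_inf a q \<noteq> 0"
  unfolding qpoch_inf_def using assms
  by (intro prodinf_nonzero convergent_prod_qpoch) auto

text \<open>This is the limit of \<open>qpoch_add\<close> as the number of factors grows. It
  converts shifts by powers of \<open>q\<close> inside infinite products into finite
  factorials.\<close>

lemma qpoch_inf_split: "qpoch_inf a q = qpoch a q n * qpoch_inf (a * of_real q ^ n) q"
proof (rule LIMSEQ_unique)
  show "(\<lambda>k. qpoch a q (k + n)) \<longlonglongrightarrow> qpoch_inf a q"
    using qpoch_tendsto by (rule LIMSEQ_ignore_initial_segment)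
  show "(\<lambda>k. qpoch a q (k + n)) \<longlonglongrightarrow> qpoch a q n * qpoch_inf (a * of_real q ^ n) q"
    unfolding add.commute[of _ n] qpoch_add by (intro tendsto_intros qpoch_tendsto)
qed

lemma qpoch_bounded: obtains C where "\<And>n. norm (qpoch a q n) \<le> C" "C > 0"
  using convergent_imp_Bseq[OF convergentI[OF qpoch_tendsto[of a]]] unfolding Bseq_def by blast

text \<open>No factor vanishes, so the infinite product is nonzero; the reciprocals therefore
  converge and are bounded.\<close>

lemma inverse_qpoch_bounded:
  assumes "\<And>j. a * of_real q ^ j \<noteq> 1"
  obtains C where "\<And>n. norm (inverse (qpoch a q n)) \<le> C" "C > 0"
proof -
  have "(\<lambda>n. inverse (qpoch a q n)) \<longlonglongrightarrow> inverse (qpoch_inf a q)"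
    using qpoch_inf_nonzero[OF assms] by (intro tendsto_inverse qpoch_tendsto)
  from convergent_imp_Bseq[OF convergentI[OF this]] show ?thesis
    using that unfolding Bseq_def by blast
qed

section \<open>Power series with bounded coefficients\<close>

lemma summable_bounded_times_power:
  fixes u :: "nat \<Rightarrow> complex"
  assumes "\<And>k. norm (u k) \<le> C" "norm z < 1"
  shows "summable (\<lambda>k. norm (u k * z ^ k))"
proof (rule summable_comparison_test)
  show "summable (\<lambda>k. C * norm z ^ k)"
    using assms by (intro summable_mult summable_geometric) simp
  show "\<exists>N. \<forall>n\<ge>N. norm (norm (u n * z ^ n)) \<le> C * norm z ^ n"
    using assms by (auto simp: norm_mult norm_power intro!: mult_right_mono)
qed

lemma norm_mult_q_power_le: "norm (z * of_real q ^ N :: complex) \<le> norm z"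
  using norm_q_power_le[of N] by (simp add: norm_mult mult_left_le)

text \<open>Supplies the limit when the recurrences behind the q-binomial and q-Gauss sums are
  iterated. Every term with \<open>k > 0\<close> carries a factor of size at most
  \<open>q ^ N\<close>, so the distance to 1 is of order \<open>q ^ N\<close>. The coefficients may
  depend on \<open>N\<close> since the q-Gauss iteration also moves a denominator parameter.\<close>

lemma suminf_scaled_tendsto_1:
  fixes u :: "nat \<Rightarrow> nat \<Rightarrow> complex"
  assumes bound: "\<And>N k. norm (u N k) \<le> C" and u0: "\<And>N. u N 0 = 1" and z: "norm z < 1"
  shows "(\<lambda>N. \<Sum>k. u N k * (z * of_real q ^ N) ^ k) \<longlonglongrightarrow> 1"
proof -
  define v where "v N k = u N k * (z * of_real q ^ N) ^ k" for N k
  have summ: "summable (\<lambda>k. norm (v N k))" for N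
    unfolding v_def
    by (rule summable_bounded_times_power) (use bound norm_mult_q_power_le[of z N] z in auto)
  have summ': "summable (\<lambda>k. norm (v N (Suc k)))" for N
    using summ[of N] by (subst summable_Suc_iff)
  have C: "C \<ge> 0" using order_trans[OF norm_ge_zero bound] .
  define K where "K = C * (\<Sum>k. norm z ^ Suc k)"
  have geo: "summable (\<lambda>k. norm z ^ Suc k)"
    using z by (simp add: summable_Suc_iff)
  have diff: "norm ((\<Sum>k. v N k) - 1) \<le> K * q ^ N" for N
  proof -
    have "(\<Sum>k. v N k) - 1 = (\<Sum>k. v N (Suc k))"
      using suminf_split_head[OF summable_norm_cancel[OF summ[of N]]] by (simp add: v_def u0)
    also have "norm \<dots> \<le> (\<Sum>k. norm (v N (Suc k)))"
      by (intro summable_norm summ')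
    also have "\<dots> \<le> (\<Sum>k. (C * q ^ N) * norm z ^ Suc k)"
    proof (rule suminf_le)
      fix k
      have "(q ^ N) ^ Suc k \<le> q ^ N"
        using q_pos q_less_1 by (simp add: mult_left_le power_le_one)
      then have "norm (z * of_real q ^ N) ^ Suc k \<le> norm z ^ Suc k * q ^ N"
        unfolding norm_mult power_mult_distrib
        using q_pos by (intro mult_left_mono) (auto simp: norm_power)
      then have "norm (v N (Suc k)) \<le> C * (norm z ^ Suc k * q ^ N)"
        unfolding v_def norm_mult norm_power[of "z * _"] by (intro mult_mono bound C) auto
      then show "norm (v N (Suc k)) \<le> (C * q ^ N) * norm z ^ Suc k"
        by (simp add: mult_ac)
    qed (intro summ' summable_mult geo)+
    also have "\<dots> = K * q ^ N"
      unfolding K_def suminf_mult[OF geo] by (simp add: mult_ac)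
    finally show ?thesis .
  qed
  have "(\<lambda>N. K * q ^ N) \<longlonglongrightarrow> 0"
    using q_pos q_less_1 by (intro tendsto_mult_right_zero LIMSEQ_power_zero) simp
  then have "(\<lambda>N. (\<Sum>k. v N k) - 1) \<longlonglongrightarrow> 0"
    by (rule Lim_null_comparison[rotated]) (simp add: diff)
  then show ?thesis unfolding v_def by (rule LIM_zero_cancel)
qed

section \<open>The q-binomial theorem\<close>

lemma of_real_q_neq_1: "of_real q * of_real q ^ j \<noteq> (1 :: complex)"
  by (rule mult_q_power_neq_1[OF norm_of_real_q_less_1])

lemma qpoch_q_nonzero [simp]: "qpoch (of_real q) q n \<noteq> 0"
  by (intro qpoch_nonzero of_real_q_neq_1)

lemma q_binomial_coeff_bounded:
  obtains C where "\<And>n. norm (qpoch a q n / qpoch (of_real q) q n) \<le> C"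
proof -
  obtain A where A: "\<And>n. norm (qpoch a q n) \<le> A" "A > 0"
      using qpoch_bounded[of a] by blast
  obtain B where B: "\<And>n. norm (inverse (qpoch (of_real q) q n)) \<le> B"
    using inverse_qpoch_bounded[OF of_real_q_neq_1] by blast
  show ?thesis
    by (rule that[of "A * B"])
       (use A B in \<open>auto simp: divide_inverse norm_mult simp del: norm_inverse intro!: mult_mono\<close>)
qed

text \<open>The coefficient recurrence gives \<open>(1 - w) * F w = (1 - a * w) * F (w * q)\<close>
  for the sum \<open>F\<close>. Iterating it at \<open>z\<close> produces the two finite factorials,
  and \<open>F (z * q ^ N)\<close> tends to 1.\<close>

theorem q_binomial:
  assumes z: "norm z < 1"
  shows "(\<lambda>n. qpoch a q n / qpoch (of_real q) q n * z ^ n) sums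
    (qpoch_inf (a * z) q / qpoch_inf z q)"
proof -
  define c where "c n = qpoch a q n / qpoch (of_real q) q n" for n
  define F where "F w = (\<Sum>n. c n * w ^ n)" for w
  obtain C where C: "\<And>n. norm (c n) \<le> C"
    unfolding c_def using q_binomial_coeff_bounded[of a] by blast
  have summ: "summable (\<lambda>n. c n * w ^ n)" if "norm w < 1" for w
    by (rule summable_norm_cancel[OF summable_bounded_times_power[OF C that]])
  have rec: "c (Suc n) * (1 - of_real q ^ Suc n) = c n * (1 - a * of_real q ^ n)" for n
    using qpoch_q_nonzero[of n] of_real_q_neq_1[of n]
    by (simp add: c_def qpoch_Suc field_simps)
  have qw: "norm (w * of_real q) < 1" if "norm w < 1" for w :: complex
    using norm_mult_q_power_le[of w 1] that by simp
  have F_rec: "(1 - w) * F w = (1 - a * w) * F (w * of_real q)" if w: "norm w < 1" for w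
  proof -
    have s: "(\<lambda>n. c n * w ^ n) sums F w"
      and s': "(\<lambda>n. c n * (w * of_real q) ^ n) sums F (w * of_real q)"
      unfolding F_def using summ[OF w] summ[OF qw[OF w]] by (auto intro: summable_sums)
    have "(\<lambda>n. c n * w ^ n - c n * (w * of_real q) ^ n) sums (F w - F (w * of_real q))"
      by (intro sums_diff s s')
    \<comment> \<open>The terms at \<open>n = 0\<close> cancel, so the series can start at index 1,
      where the recurrence \<open>rec\<close> applies.\<close>
    then have "(\<lambda>n. c (Suc n) * w ^ Suc n - c (Suc n) * (w * of_real q) ^ Suc n)
        sums (F w - F (w * of_real q))"
      by (subst sums_Suc_iff) simp
    also have "(\<lambda>n. c (Suc n) * w ^ Suc n - c (Suc n) * (w * of_real q) ^ Suc n) =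
        (\<lambda>n. w * (c n * w ^ n) - a * w * (c n * (w * of_real q) ^ n))"
    proof
      fix n
      have "c (Suc n) * w ^ Suc n - c (Suc n) * (w * of_real q) ^ Suc n =
          w ^ Suc n * (c (Suc n) * (1 - of_real q ^ Suc n))"
        by (simp add: power_mult_distrib algebra_simps)
      also have "\<dots> = w * (c n * w ^ n) - a * w * (c n * (w * of_real q) ^ n)"
        unfolding rec by (simp add: power_mult_distrib algebra_simps)
      finally show "c (Suc n) * w ^ Suc n - c (Suc n) * (w * of_real q) ^ Suc n =
          w * (c n * w ^ n) - a * w * (c n * (w * of_real q) ^ n)" .
    qed
    finally have "F w - F (w * of_real q) = w * F w - a * w * F (w * of_real q)"
      by (rule sums_unique2) (intro sums_diff sums_mult s s')
    then show ?thesis by (simp add: algebra_simps)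
  qed
  have iter: "qpoch z q N * F z = qpoch (a * z) q N * F (z * of_real q ^ N)" for N
  proof (induction N)
    case (Suc N)
    have "norm (z * of_real q ^ N) < 1"
      using norm_mult_q_power_le[of z N] z by linarith
    from F_rec[OF this] Suc show ?case
      by (simp add: qpoch_Suc mult_ac) (metis (no_types, lifting) mult.assoc mult.left_commute)
  qed simp
  have "(\<lambda>N. F (z * of_real q ^ N)) \<longlonglongrightarrow> 1"
    unfolding F_def by (rule suminf_scaled_tendsto_1[OF C _ z]) (simp add: c_def)
  then have "(\<lambda>N. qpoch (a * z) q N * F (z * of_real q ^ N)) \<longlonglongrightarrow> qpoch_inf (a * z) q * 1"
    by (intro tendsto_mult qpoch_tendsto)
  moreover have "(\<lambda>N. qpoch z q N * F z) \<longlonglongrightarrow> qpoch_inf z q * F z"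
    by (intro tendsto_intros qpoch_tendsto)
  ultimately have "qpoch_inf z q * F z = qpoch_inf (a * z) q"
    unfolding iter by (auto dest: LIMSEQ_unique)
  moreover have "qpoch_inf z q \<noteq> 0"
    by (intro qpoch_inf_nonzero mult_q_power_neq_1 z)
  ultimately have "F z = qpoch_inf (a * z) q / qpoch_inf z q"
    by (simp add: field_simps)
  then show ?thesis
    using summable_sums[OF summ[OF z]] by (simp add: F_def c_def)
qed

section \<open>The q-Gauss sum\<close>

text \<open>Replacing \<open>c\<close> by \<open>c * q ^ N\<close> with \<open>a\<close> and
  \<open>b\<close> fixed also scales the argument \<open>c / (a * b)\<close> by
  \<open>q ^ N\<close>. A contiguous relation links consecutive \<open>N\<close>; its iteration
  drives the sum to 1 and leaves the quotient of infinite products.\<close>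

theorem q_gauss:
  assumes a: "a \<noteq> 0" and b: "b \<noteq> 0" and c: "\<And>j. c * of_real q ^ j \<noteq> 1"
    and z: "norm (c / (a * b)) < 1"
  shows "(\<lambda>k. qpoch a q k * qpoch b q k / (qpoch (of_real q) q k * qpoch c q k) * (c / (a * b)) ^ k)
    sums (qpoch_inf (c / a) q * qpoch_inf (c / b) q / (qpoch_inf c q * qpoch_inf (c / (a * b)) q))"
proof -
  define u where "u N k = qpoch a q k * qpoch b q k /
    (qpoch (of_real q) q k * qpoch (c * of_real q ^ N) q k)" for N k
  define t where "t N k = u N k * (c / (a * b) * of_real q ^ N) ^ k" for N k
  define S where "S N = (\<Sum>k. t N k)" for N
  obtain C where C: "\<And>N k. norm (u N k) \<le> C"
  proof -
    obtain A where A: "\<And>n. norm (qpoch a q n / qpoch (of_real q) q n) \<le> A"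
      using q_binomial_coeff_bounded[of a] by blast
    obtain B where B: "\<And>n. norm (qpoch b q n) \<le> B" "B > 0"
      using qpoch_bounded[of b] by blast
    obtain D where D: "\<And>n. norm (qpoch c q n) \<le> D" "D > 0"
      using qpoch_bounded[of c] by blast
    obtain D' where D': "\<And>n. norm (inverse (qpoch c q n)) \<le> D'" "D' > 0"
      using inverse_qpoch_bounded[OF c] by blast
    have A0: "A \<ge> 0" using order_trans[OF norm_ge_zero A] .
    have "norm (u N k) \<le> A * B * (D * D')" for N k
    proof -
      \<comment> \<open>Writing the shifted factorial as a quotient of two factorials with the
        unshifted base \<open>c\<close> makes the bound uniform in \<open>N\<close>.\<close>
      have "u N k = qpoch a q k / qpoch (of_real q) q k * qpoch b q k *
          (qpoch c q N * inverse (qpoch c q (N + k)))"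
        using qpoch_nonzero[OF c, of N] by (simp add: u_def qpoch_add field_simps)
      also have "norm \<dots> \<le> A * B * (D * D')"
        unfolding norm_mult[of "_ * _"] norm_mult[of "_ / _"] norm_mult[of "qpoch c q N"]
        by (intro mult_mono A B D D' mult_nonneg_nonneg A0) (use B D D' in auto)
      finally show ?thesis .
    qed
    then show ?thesis using that by blast
  qed
  have zN: "norm (c / (a * b) * of_real q ^ N) < 1" for N
    using norm_mult_q_power_le[of "c / (a * b)" N] z by linarith
  have summ: "summable (t N)" for N
    unfolding t_def
    by (rule summable_norm_cancel[OF summable_bounded_times_power[OF C zN]])
  have cN: "c * of_real q ^ N * of_real q ^ k \<noteq> 1" for N k
    using c[of "N + k"] by (simp add: power_add mult_ac)
  text \<open>The contiguous relation telescopes with certificate \<open>-(1 - q\<^sup>k) t\<^sub>k\<close>.\<close>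
  have S_rec: "(1 - c / (a * b) * of_real q ^ N) * (1 - c * of_real q ^ N) * S N =
      (1 - c / a * of_real q ^ N) * (1 - c / b * of_real q ^ N) * S (Suc N)" for N
  proof -
    define d where "d = c * of_real q ^ N"
    define R where "R k = - (1 - of_real q ^ k) * t N k" for k
    have d: "d * of_real q ^ k \<noteq> 1" for k using cN by (simp add: d_def)
    have d1: "d \<noteq> 1" using d[of 0] by simp
    have step: "R (Suc k) - R k = (1 - d / (a * b)) * t N k -
        (1 - d / a) * (1 - d / b) / (1 - d) * t (Suc N) k" for k
    proof -
      define Q :: complex where "Q = of_real q ^ k"
      have dQ: "1 - d * Q \<noteq> 0" using d[of k] by (simp add: Q_def)
      have qQ: "1 - of_real q * Q \<noteq> 0" using of_real_q_neq_1[of k] by (simp add: Q_def)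
      have t1: "t N (Suc k) = t N k *
          ((1 - a * Q) * (1 - b * Q) / ((1 - of_real q * Q) * (1 - d * Q)) * (d / (a * b)))"
        by (simp add: t_def u_def qpoch_Suc Q_def d_def mult_ac)
      \<comment> \<open>Both sides are the factorial of length \<open>k + 1\<close> at
        \<open>d\<close>, split at its last and at its first factor.\<close>
      have "qpoch d q k * (1 - d * Q) = (1 - d) * qpoch (d * of_real q) q k"
        using qpoch_add[of d q 1 k] by (simp add: qpoch_Suc Q_def)
      then have "qpoch (d * of_real q) q k = qpoch d q k * (1 - d * Q) / (1 - d)"
        using d1 by (simp add: field_simps)
      then have t2: "t (Suc N) k = t N k * ((1 - d) * Q / (1 - d * Q))"
        using d1 by (simp add: t_def u_def d_def Q_def power_mult_distrib power_divide
            power_mult[symmetric] mult_ac power_commutes)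
      have "R (Suc k) = - t N k * ((1 - a * Q) * (1 - b * Q) / (1 - d * Q) * (d / (a * b)))"
      proof -
        have "R (Suc k) = - (1 - of_real q * Q) * t N (Suc k)"
          by (simp add: R_def Q_def)
        moreover have "- s * (T * (X / (s * Y) * Z)) = - T * (X / Y * Z)" if "s \<noteq> 0"
          for s T X Y Z :: complex using that by simp
        ultimately show ?thesis unfolding t1 using qQ by metis
      qed
      moreover have "R k = - (1 - Q) * t N k" by (simp add: R_def Q_def)
      moreover have "- T * X - - (1 - Q) * T = T * ((1 - Q) - X)" for T X :: complex
        by (simp add: algebra_simps)
      ultimately have "R (Suc k) - R k = t N k *
          ((1 - Q) - (1 - a * Q) * (1 - b * Q) / (1 - d * Q) * (d / (a * b)))"
        by metis
      \<comment> \<open>After multiplication by \<open>1 - d * Q\<close> the quadratic terms in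
        \<open>Q\<close> on the left cancel, and both sides become the same linear polynomial in
        \<open>Q\<close>.\<close>
      also have "(1 - Q) - (1 - a * Q) * (1 - b * Q) / (1 - d * Q) * (d / (a * b)) =
          (1 - d / (a * b)) - (1 - d / a) * (1 - d / b) * Q / (1 - d * Q)"
        using dQ a b by (simp add: divide_simps) (simp add: algebra_simps)
      also have "t N k * \<dots> = (1 - d / (a * b)) * t N k -
          (1 - d / a) * (1 - d / b) / (1 - d) * t (Suc N) k"
      proof -
        have "T * (X - Y * Q / Z) = X * T - Y / (1 - d) * (T * ((1 - d) * Q / Z))"
          for T X Y Z using d1 by (simp add: right_diff_distrib)
        then show ?thesis unfolding t2 .
      qed
      finally show ?thesis .
    qed
    \<comment> \<open>Both boundary terms vanish: \<open>R\<close> tends to 0 with the terms of the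
      convergent series, and \<open>R 0 = 0\<close> because of the factor
      \<open>1 - q ^ 0\<close>.\<close>
    have "R \<longlonglongrightarrow> - (1 - 0) * 0"
      unfolding R_def by (intro tendsto_mult tendsto_minus tendsto_diff tendsto_const
          LIMSEQ_power_zero norm_of_real_q_less_1 summable_LIMSEQ_zero[OF summ])
    then have "R \<longlonglongrightarrow> 0" by simp
    then have "(\<lambda>k. R (Suc k) - R k) sums (0 - R 0)"
      by (rule telescope_sums)
    then have "(\<lambda>k. R (Suc k) - R k) sums 0" by (simp add: R_def)
    moreover have "(\<lambda>k. R (Suc k) - R k) sums ((1 - d / (a * b)) * S N -
        (1 - d / a) * (1 - d / b) / (1 - d) * S (Suc N))"
      unfolding step S_def by (intro sums_diff sums_mult summable_sums summ)
    ultimately have "(1 - d / (a * b)) * S N - (1 - d / a) * (1 - d / b) / (1 - d) * S (Suc N) = 0"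
      by (rule sums_unique2[symmetric])
    then have "(1 - d / (a * b)) * (1 - d) * S N = (1 - d / a) * (1 - d / b) * S (Suc N)"
      using d1 by (simp add: field_simps)
    then show ?thesis by (simp add: d_def)
  qed
  have iter: "qpoch (c / (a * b)) q N * qpoch c q N * S 0 =
      qpoch (c / a) q N * qpoch (c / b) q N * S N" for N
  proof (induction N)
    case (Suc N)
    have "qpoch (c / (a * b)) q (Suc N) * qpoch c q (Suc N) * S 0 =
        (1 - c / (a * b) * of_real q ^ N) * (1 - c * of_real q ^ N) *
        (qpoch (c / (a * b)) q N * qpoch c q N * S 0)"
      by (simp only: qpoch_Suc mult_ac)
    also have "\<dots> = qpoch (c / a) q N * qpoch (c / b) q N *
        ((1 - c / (a * b) * of_real q ^ N) * (1 - c * of_real q ^ N) * S N)"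
      unfolding Suc by (simp only: mult_ac)
    also have "\<dots> = qpoch (c / a) q (Suc N) * qpoch (c / b) q (Suc N) * S (Suc N)"
      unfolding S_rec by (simp only: qpoch_Suc mult_ac)
    finally show ?case .
  qed simp
  have "S \<longlonglongrightarrow> 1"
    unfolding S_def t_def by (rule suminf_scaled_tendsto_1[OF C _ z]) (simp add: u_def)
  then have "(\<lambda>N. qpoch (c / a) q N * qpoch (c / b) q N * S N)
      \<longlonglongrightarrow> qpoch_inf (c / a) q * qpoch_inf (c / b) q * 1"
    by (intro tendsto_mult qpoch_tendsto)
  moreover have "(\<lambda>N. qpoch (c / (a * b)) q N * qpoch c q N * S 0)
      \<longlonglongrightarrow> qpoch_inf (c / (a * b)) q * qpoch_inf c q * S 0"
    by (intro tendsto_intros qpoch_tendsto)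
  ultimately have "qpoch_inf (c / (a * b)) q * qpoch_inf c q * S 0 =
      qpoch_inf (c / a) q * qpoch_inf (c / b) q"
    unfolding iter by (auto dest: LIMSEQ_unique)
  moreover have "qpoch_inf (c / (a * b)) q \<noteq> 0" "qpoch_inf c q \<noteq> 0"
    by (intro qpoch_inf_nonzero mult_q_power_neq_1 z c)+
  ultimately have "S 0 = qpoch_inf (c / a) q * qpoch_inf (c / b) q /
      (qpoch_inf c q * qpoch_inf (c / (a * b)) q)"
    by (simp add: field_simps)
  then show ?thesis
    using summable_sums[OF summ[of 0]] by (simp add: S_def t_def[abs_def] u_def)
qed

section \<open>The double series behind the moments\<close>

text \<open>With \<open>n = k + j\<close>, the factorial of \<open>c\<close> of length
  \<open>n\<close> splits into its first \<open>k\<close> factors, which cancel, and one at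
  \<open>c * q ^ k\<close> of length \<open>j\<close>. The q-binomial sum over \<open>j\<close> then
  contributes the reciprocal factorial of \<open>c * E\<close> of length \<open>k\<close>, leaving a
  q-Gauss sum with \<open>c * E\<close> in place of \<open>c\<close>.\<close>

lemma q_beta_sum:
  assumes a: "a \<noteq> 0" and b: "b \<noteq> 0" and c: "norm c < 1" and E: "norm E < 1"
    and w: "norm (c * E / (a * b)) < 1"
  shows "((\<lambda>n. E ^ n * (qpoch c q n / qpoch (of_real q) q n) *
      (\<Sum>k\<le>n. qpoch a q k * qpoch b q k / (qpoch c q k * qpoch (of_real q) q k) *
         (qpoch (of_real q) q n / qpoch (of_real q) q (n - k)) * (c / (a * b)) ^ k)) has_sum
      (qpoch_inf (c * E / a) q * qpoch_inf (c * E / b) q /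
       (qpoch_inf E q * qpoch_inf (c * E / (a * b)) q))) UNIV"
proof -
  define w where "w = c * E / (a * b)"
  define A where "A k = qpoch a q k * qpoch b q k / qpoch (of_real q) q k" for k
  define B where "B k j = qpoch (c * of_real q ^ k) q j / qpoch (of_real q) q j" for k j
  \<comment> \<open>The summand in the coordinates \<open>(k, j)\<close>: the part
    \<open>E ^ k\<close> of \<open>E ^ n\<close> is absorbed into \<open>w ^ k\<close>.\<close>
  define g where "g = (\<lambda>(k, j). (A k * w ^ k) * (B k j * E ^ j))"
  have c_nz: "c * of_real q ^ j \<noteq> 1" for j
    by (rule mult_q_power_neq_1[OF c])
  note qn = qpoch_q_nonzero
  have w1: "norm w < 1" using w by (simp add: w_def)
  have cE: "norm (c * E) < 1"
    using c E by (smt (verit) norm_mult mult_left_le norm_ge_zero mult_left_le_one_le)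
  have cE_nz: "c * E * of_real q ^ j \<noteq> 1" for j
    by (rule mult_q_power_neq_1[OF cE])
  have E_nz: "E * of_real q ^ j \<noteq> 1" for j
    by (rule mult_q_power_neq_1[OF E])
  obtain C1 where C1: "\<And>k. norm (A k) \<le> C1" "C1 > 0"
  proof -
    obtain X where X: "\<And>n. norm (qpoch a q n / qpoch (of_real q) q n) \<le> X"
      using q_binomial_coeff_bounded[of a] by blast
    obtain Y where Y: "\<And>n. norm (qpoch b q n) \<le> Y" "Y > 0"
      using qpoch_bounded[of b] by blast
    have X0: "X \<ge> 0" using order_trans[OF norm_ge_zero X] .
    \<comment> \<open>The added 1 makes the bound strictly positive, as \<open>X\<close> is only
      known to be nonnegative.\<close>
    have "norm (A k) \<le> X * Y + 1" for k
    proof -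
      have "norm (A k) = norm (qpoch a q k / qpoch (of_real q) q k) * norm (qpoch b q k)"
        unfolding A_def norm_mult[symmetric] by simp
      also have "\<dots> \<le> X * Y" by (intro mult_mono X Y X0) auto
      finally show ?thesis by simp
    qed
    moreover have "X * Y + 1 > 0" using X0 Y by (simp add: add_nonneg_pos)
    ultimately show ?thesis using that by blast
  qed
  obtain C2 where C2: "\<And>k j. norm (B k j) \<le> C2" "C2 > 0"
  proof -
    obtain X where X: "\<And>n. norm (inverse (qpoch (of_real q) q n)) \<le> X" "X > 0"
      using inverse_qpoch_bounded[OF of_real_q_neq_1] by blast
    obtain Y where Y: "\<And>n. norm (qpoch c q n) \<le> Y" "Y > 0"
      using qpoch_bounded[of c] by blast
    obtain Z where Z: "\<And>n. norm (inverse (qpoch c q n)) \<le> Z" "Z > 0"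
      using inverse_qpoch_bounded[OF c_nz] by blast
    have "norm (B k j) \<le> Y * Z * X" for k j
    proof -
      have "B k j = qpoch c q (k + j) * inverse (qpoch c q k) * inverse (qpoch (of_real q) q j)"
        using qpoch_nonzero[OF c_nz, of k] unfolding qpoch_add[of c q k j]
        by (simp add: B_def divide_inverse)
      also have "norm \<dots> \<le> Y * Z * X"
        unfolding norm_mult by (intro mult_mono X Y Z mult_nonneg_nonneg) (use X Y Z in auto)
      finally show ?thesis .
    qed
    moreover have "Y * Z * X > 0" using X Y Z by simp
    ultimately show ?thesis using that by blast
  qed
  have "(\<lambda>(k, j). w ^ k * E ^ j) summable_on UNIV \<times> UNIV"
    by (rule has_sum_imp_summable[OF has_sum_Times[OF geometric_has_sum[OF w1] geometric_has_sum[OF E]]])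
  then have "g summable_on UNIV \<times> UNIV"
  proof (rule summable_on_comparison_complex)
    fix kj :: "nat \<times> nat"
    obtain k j where kj: "kj = (k, j)" by force
    have "norm (A k * B k j) \<le> C1 * C2"
      unfolding norm_mult by (intro mult_mono C1 C2) (use C1 C2 in auto)
    then have "norm (A k * B k j) * norm (w ^ k * E ^ j) \<le> C1 * C2 * norm (w ^ k * E ^ j)"
      by (intro mult_right_mono) auto
    then show "norm (g kj) \<le> C1 * C2 * norm (case kj of (k, j) \<Rightarrow> w ^ k * E ^ j)"
      by (simp add: kj g_def norm_mult mult_ac)
  qed
  then obtain S where S: "(g has_sum S) (UNIV \<times> UNIV)" by (auto simp: summable_on_def)
  have inner: "((\<lambda>j. g (k, j)) has_sum
      (qpoch_inf (c * E) q / qpoch_inf E q *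
       (qpoch a q k * qpoch b q k / (qpoch (of_real q) q k * qpoch (c * E) q k) * w ^ k))) UNIV" for k
  proof -
    have "((\<lambda>j. B k j * E ^ j) has_sum (qpoch_inf (c * of_real q ^ k * E) q / qpoch_inf E q)) UNIV"
      unfolding B_def
      by (intro norm_summable_imp_has_sum q_binomial[OF E])
         (use summable_bounded_times_power[OF C2(1) E] in \<open>simp add: B_def\<close>)
    from has_sum_cmult_right[OF this, of "A k * w ^ k"]
    have "((\<lambda>j. g (k, j)) has_sum
        (A k * w ^ k * (qpoch_inf (c * of_real q ^ k * E) q / qpoch_inf E q))) UNIV"
      by (simp add: g_def)
    also have "c * of_real q ^ k * E = c * E * of_real q ^ k" by (simp add: mult_ac)
    also have "A k * w ^ k * (qpoch_inf (c * E * of_real q ^ k) q / qpoch_inf E q) =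
        qpoch_inf (c * E) q / qpoch_inf E q *
       (qpoch a q k * qpoch b q k / (qpoch (of_real q) q k * qpoch (c * E) q k) * w ^ k)"
      using qpoch_nonzero[OF cE_nz, of k]
      unfolding A_def qpoch_inf_split[of "c * E" k]
      by (simp add: mult.commute mult.left_commute)
    finally show ?thesis .
  qed
  have "(\<lambda>k. qpoch_inf (c * E) q / qpoch_inf E q *
       (qpoch a q k * qpoch b q k / (qpoch (of_real q) q k * qpoch (c * E) q k) * w ^ k)) sums S"
    by (rule has_sum_imp_sums[OF has_sum_SigmaD[OF S inner]])
  moreover have "(\<lambda>k. qpoch_inf (c * E) q / qpoch_inf E q *
       (qpoch a q k * qpoch b q k / (qpoch (of_real q) q k * qpoch (c * E) q k) * w ^ k)) sums
      (qpoch_inf (c * E) q / qpoch_inf E q * (qpoch_inf (c * E / a) q * qpoch_inf (c * E / b) q /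
       (qpoch_inf (c * E) q * qpoch_inf w q)))"
    unfolding w_def by (intro sums_mult q_gauss[OF a b cE_nz w])
  ultimately have "S = qpoch_inf (c * E) q / qpoch_inf E q * (qpoch_inf (c * E / a) q *
      qpoch_inf (c * E / b) q / (qpoch_inf (c * E) q * qpoch_inf w q))"
    by (rule sums_unique2)
  also have "\<dots> = qpoch_inf (c * E / a) q * qpoch_inf (c * E / b) q /
      (qpoch_inf E q * qpoch_inf w q)"
    using qpoch_inf_nonzero[OF cE_nz] by simp
  finally have S_eq: "S = \<dots>" .
  \<comment> \<open>The triangle \<open>k <= n\<close> reindexes all pairs \<open>(k, j)\<close>, so
    \<open>S\<close> is also the sum along the diagonals \<open>k + j = n\<close>.\<close>
  have "((\<lambda>(n, k). g (k, n - k)) has_sum S) (SIGMA n:UNIV. {..n})"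
    by (subst has_sum_reindex_bij_witness[where T = "UNIV \<times> UNIV" and h = g
          and i = "\<lambda>(k, j). (k + j, k)" and j = "\<lambda>(n, k). (k, n - k)"]) (use S in auto)
  then have "((\<lambda>n. \<Sum>k\<le>n. g (k, n - k)) has_sum S) UNIV"
    by (rule has_sum_SigmaD) (auto intro!: has_sum_finiteI)
  also have "(\<lambda>n. \<Sum>k\<le>n. g (k, n - k)) = (\<lambda>n. E ^ n * (qpoch c q n / qpoch (of_real q) q n) *
      (\<Sum>k\<le>n. qpoch a q k * qpoch b q k / (qpoch c q k * qpoch (of_real q) q k) *
         (qpoch (of_real q) q n / qpoch (of_real q) q (n - k)) * (c / (a * b)) ^ k))"
  proof
    fix n
    show "(\<Sum>k\<le>n. g (k, n - k)) = E ^ n * (qpoch c q n / qpoch (of_real q) q n) *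
      (\<Sum>k\<le>n. qpoch a q k * qpoch b q k / (qpoch c q k * qpoch (of_real q) q k) *
         (qpoch (of_real q) q n / qpoch (of_real q) q (n - k)) * (c / (a * b)) ^ k)"
      unfolding sum_distrib_left
    proof (rule sum.cong)
      fix k assume "k \<in> {..n}"
      then obtain j where n: "n = k + j" by (auto simp: le_iff_add)
      show "g (k, n - k) = E ^ n * (qpoch c q n / qpoch (of_real q) q n) *
         (qpoch a q k * qpoch b q k / (qpoch c q k * qpoch (of_real q) q k) *
         (qpoch (of_real q) q n / qpoch (of_real q) q (n - k)) * (c / (a * b)) ^ k)"
        using qpoch_nonzero[OF c_nz, of k] qn[of k] qn[of j] qn[of n]
        unfolding n g_def A_def B_def w_def qpoch_add[of c q k j]
        by (simp add: power_add power_mult_distrib power_divide mult_ac)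
    qed simp
  qed
  finally show ?thesis unfolding S_eq w_def .
qed

section \<open>The terminating 3phi1 at powers of q\<close>

text \<open>Multiplied by \<open>q ^ n\<close>, the factor with index \<open>j\<close> becomes
  \<open>- (q ^ j) * (1 - q ^ (n - j))\<close>, and the last bracket is one of the top factors of
  the factorial of \<open>q\<close> of length \<open>n\<close>. The collected signs and powers of
  \<open>q\<close> are those of the extra factor in a 3phi1.\<close>

lemma qpoch_inverse_q_power:
  assumes "k \<le> n"
  shows "qpoch (inverse (of_real (q ^ n))) q k * of_real (q ^ n) ^ k * qpoch (of_real q) q (n - k) =
    qpoch (of_real q) q n * ((-1) ^ k * of_real q ^ (k choose 2))"
  using assms
proof (induction k)
  case (Suc k)
  define Q :: complex where "Q = of_real (q ^ n)"
  have Q0: "Q \<noteq> 0" using q_pos by (simp add: Q_def)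
  have nk: "n - k = Suc (n - Suc k)" using Suc.prems by simp
  have Qk: "Q = of_real q ^ k * (of_real q * of_real q ^ (n - Suc k))"
    using Suc.prems by (simp add: Q_def flip: power_Suc power_add)
  have step: "(1 - inverse Q * of_real q ^ k) * Q =
      - (of_real q ^ k) * (1 - of_real q * of_real q ^ (n - Suc k))"
    using Q0 by (simp add: algebra_simps) (simp add: Qk algebra_simps)
  have "qpoch (inverse Q) q (Suc k) * Q ^ Suc k * qpoch (of_real q) q (n - Suc k) =
      qpoch (inverse Q) q k * Q ^ k * qpoch (of_real q) q (n - Suc k) *
      ((1 - inverse Q * of_real q ^ k) * Q)"
    unfolding qpoch_Suc power_Suc by (simp only: mult_ac)
  also have "\<dots> =
      (qpoch (inverse Q) q k * Q ^ k * qpoch (of_real q) q (n - k)) * - (of_real q ^ k)"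
    unfolding step nk qpoch_Suc by (simp add: mult_ac)
  also have "\<dots> = qpoch (of_real q) q n * ((-1) ^ Suc k * of_real q ^ (Suc k choose 2))"
    using Suc by (simp add: Q_def numeral_2_eq_2 power_add mult_ac)
  finally show ?case unfolding Q_def .
qed (simp add: numeral_2_eq_2)

text \<open>The extra factor of the series has exponent \<open>1 + 1 - 3 = -1\<close>, so it cancels
  against \<open>qpoch_inverse_q_power\<close>. Terms beyond \<open>n\<close> vanish because the
  factor with index \<open>n\<close> of the factorial of \<open>q ^ (-n)\<close> is 0.\<close>

lemma basic_hypergeom_31_q_power:
  "basic_hypergeom [a, b, inverse (of_real (q ^ n))] [c] q (of_real (q ^ n) * w) =
    (\<Sum>k\<le>n. qpoch a q k * qpoch b q k / (qpoch c q k * qpoch (of_real q) q k) *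
       (qpoch (of_real q) q n / qpoch (of_real q) q (n - k)) * w ^ k)"
proof -
  define T where "T k = qpochs [a, b, inverse (of_real (q ^ n))] q k / qpochs ([c] @ [of_real q]) q k *
    ((-1) ^ k * of_real q ^ (k choose 2)) powi (1 + int (length [c]) -
      int (length [a, b, inverse (of_real (q ^ n))])) * (of_real (q ^ n) * w) ^ k" for k
  have "T k = 0" if "k \<notin> {..n}" for k
  proof -
    from that have "n < k" by simp
    then have "qpoch (inverse (of_real (q ^ n))) q k = 0"
      using q_pos by (auto simp: qpoch_def intro!: bexI[of _ n])
    then show ?thesis by (simp add: T_def qpochs_def)
  qed
  then have "(\<Sum>k. T k) = (\<Sum>k\<le>n. T k)" by (intro suminf_finite) auto
  also have "\<dots> = (\<Sum>k\<le>n. qpoch a q k * qpoch b q k / (qpoch c q k * qpoch (of_real q) q k) *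
       (qpoch (of_real q) q n / qpoch (of_real q) q (n - k)) * w ^ k)"
  proof (rule sum.cong)
    fix k assume "k \<in> {..n}"
    then have k: "k \<le> n" by simp
    define s :: complex where "s = (-1) ^ k * of_real q ^ (k choose 2)"
    have s: "s \<noteq> 0" using q_pos by (simp add: s_def)
    have "T k = qpoch a q k * qpoch b q k / (qpoch c q k * qpoch (of_real q) q k) *
        (qpoch (inverse (of_real (q ^ n))) q k * of_real (q ^ n) ^ k / s) * w ^ k"
      unfolding T_def s_def[symmetric]
      by (simp add: qpochs_def power_int_minus divide_inverse power_mult_distrib mult_ac)
    also have "qpoch (inverse (of_real (q ^ n))) q k * of_real (q ^ n) ^ k / s =
        qpoch (of_real q) q n / qpoch (of_real q) q (n - k)"
      using qpoch_inverse_q_power[OF k] s qpoch_q_nonzero[of "n - k"]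
      by (simp add: s_def[symmetric] frac_eq_eq)
    finally show "T k = qpoch a q k * qpoch b q k / (qpoch c q k * qpoch (of_real q) q k) *
       (qpoch (of_real q) q n / qpoch (of_real q) q (n - k)) * w ^ k" .
  qed simp
  finally show ?thesis unfolding basic_hypergeom_def T_def .
qed

section \<open>Moments of the q-hypergeometric measure\<close>

text \<open>No branch correction arises, since the logarithm of a positive real is real.\<close>

lemma of_real_power_powr: "of_real (q ^ n) powr z = (of_real q powr z :: complex) ^ n"
  using q_pos
  by (simp add: powr_def Ln_of_real ln_realpow exp_of_nat_mult[symmetric] mult_ac flip: of_real_power)

lemma norm_q_powr_less_1:
  assumes "Re z > 0"
  shows "norm (of_real q powr z :: complex) < 1"
proof -
  have "norm (of_real q powr z :: complex) = q powr Re z"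
    using q_pos by (simp add: norm_powr_real_powr)
  also have "\<dots> < 1" using assms q_pos q_less_1 by (simp add: powr_def mult_pos_neg)
  finally show ?thesis .
qed

text \<open>At \<open>t = q ^ n\<close> the weighted density is a constant times the summand of
  \<open>q_beta_sum\<close>, and the factor \<open>t ^ m\<close> merely replaces \<open>E\<close> by
  \<open>E * q ^ m\<close>. The resulting infinite products are shifted by \<open>q ^ m\<close>,
  which yields the finite factorials; the remaining \<open>1 / (1 - q)\<close> is compensated by the
  prefactor of the q-integral.\<close>

lemma qhyp_density_moment:
  fixes G H L N :: complex
  assumes C: "Re (G + H - L - N) > 0" and L: "Re L > 0" and N: "Re N > 0"
    and G: "\<And>j. of_real q powr G * of_real q ^ j \<noteq> 1"
    and H: "\<And>j. of_real q powr H * of_real q ^ j \<noteq> 1"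
  shows "((\<lambda>n. qhyp_density (H - L) (G - L) (G - L + H - N) N q (q ^ n) * of_real q ^ n *
        of_real (q ^ n) ^ m) has_sum
      (qpoch (of_real q powr N) q m * qpoch (of_real q powr L) q m /
       (qpoch (of_real q powr G) q m * qpoch (of_real q powr H) q m) / of_real (1 - q))) UNIV"
proof -
  define a b c E where "a = (of_real q powr (H - L) :: complex)"
    and "b = (of_real q powr (G - L) :: complex)"
    and "c = (of_real q powr (G - L + H - N) :: complex)"
    and "E = (of_real q powr N :: complex)"
  define g h l where "g = (of_real q powr G :: complex)"
    and "h = (of_real q powr H :: complex)" and "l = (of_real q powr L :: complex)"
  have q0: "(of_real q :: complex) \<noteq> 0" using q_pos by simp
  have nz: "a \<noteq> 0" "b \<noteq> 0" "c \<noteq> 0" "E \<noteq> 0" using q0 by (auto simp: a_def b_def c_def E_def)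
  have cEa: "c * E / a = g" and cEb: "c * E / b = h" and cEab: "c * E / (a * b) = l"
    and cab: "c / (a * b) = of_real q powr (G - L + H - N - (H - L) - (G - L))"
    unfolding a_def b_def c_def E_def g_def h_def l_def
    by (simp_all add: algebra_simps flip: powr_add powr_diff)
  \<comment> \<open>The real-part conditions are the convergence conditions: \<open>C\<close>
    controls \<open>c\<close>, \<open>N\<close> controls \<open>E\<close>, and \<open>L\<close>
    controls the q-Gauss argument \<open>c * E / (a * b) = l\<close>.\<close>
  have c1: "norm c < 1" and E1: "norm E < 1" and l1: "norm l < 1"
    unfolding c_def E_def l_def
    by (rule norm_q_powr_less_1; use C L N in \<open>simp add: algebra_simps\<close>)+
  define K where "K = qGamma q G * qGamma q H / (qGamma q N * qGamma q (G - L + H - N) * qGamma q L)"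
  define qi where "qi = qpoch_inf (of_real q) q"
  have nzi: "qi \<noteq> 0" "qpoch_inf c q \<noteq> 0" "qpoch_inf E q \<noteq> 0" "qpoch_inf l q \<noteq> 0"
      "qpoch_inf g q \<noteq> 0" "qpoch_inf h q \<noteq> 0"
    unfolding qi_def
    by (rule qpoch_inf_nonzero mult_q_power_neq_1 of_real_q_neq_1
        c1 E1 l1 G[folded g_def] H[folded h_def])+
  have c_nz: "c * of_real q ^ j \<noteq> 1" for j by (rule mult_q_power_neq_1[OF c1])
  have dens: "qhyp_density (H - L) (G - L) (G - L + H - N) N q (q ^ n) * of_real q ^ n *
        of_real (q ^ n) ^ m = K * (qi / qpoch_inf c q) *
      ((E * of_real q ^ m) ^ n * (qpoch c q n / qpoch (of_real q) q n) *
      (\<Sum>k\<le>n. qpoch a q k * qpoch b q k / (qpoch c q k * qpoch (of_real q) q k) *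
         (qpoch (of_real q) q n / qpoch (of_real q) q (n - k)) * (c / (a * b)) ^ k))" for n
  proof -
    define W where "W = (\<Sum>k\<le>n. qpoch a q k * qpoch b q k / (qpoch c q k * qpoch (of_real q) q k) *
         (qpoch (of_real q) q n / qpoch (of_real q) q (n - k)) * (c / (a * b)) ^ k)"
    have args: "N + (G - L + H - N) - (H - L) = G" "N + (G - L + H - N) - (G - L) = H"
      "G - (G - L) = L" by simp_all
    have "qhyp_density (H - L) (G - L) (G - L + H - N) N q (q ^ n) =
        K * of_real (q ^ n) powr (N - 1) *
        (qpoch_inf (of_real (q ^ n * q)) q / qpoch_inf (of_real (q ^ n) * c) q) * W"
      unfolding qhyp_density_def args K_def W_def a_def[symmetric] b_def[symmetric] c_def[symmetric]
        cab[symmetric] basic_hypergeom_31_q_power ..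
    \<comment> \<open>At \<open>t = q ^ n\<close> the two infinite products of the density leave the
      quotient of the factorials of \<open>c\<close> and \<open>q\<close> of length
      \<open>n\<close>.\<close>
    also have "qpoch_inf (of_real (q ^ n * q)) q = qi / qpoch (of_real q) q n"
      using qpoch_q_nonzero[of n]
      by (simp add: qi_def qpoch_inf_split[of "of_real q" n] mult_ac)
    also have "qpoch_inf (of_real (q ^ n) * c) q = qpoch_inf c q / qpoch c q n"
      using qpoch_nonzero[OF c_nz, of n]
      by (simp add: qpoch_inf_split[of c n] mult_ac)
    finally have 1: "qhyp_density (H - L) (G - L) (G - L + H - N) N q (q ^ n) =
        K * of_real (q ^ n) powr (N - 1) *
        ((qi / qpoch (of_real q) q n) / (qpoch_inf c q / qpoch c q n)) * W" .
    \<comment> \<open>The weight \<open>q ^ n\<close> of the q-integral cancels the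
      \<open>- 1\<close> in the exponent of \<open>t\<close>.\<close>
    have "of_real (q ^ n) powr (N - 1) * of_real q ^ n = E ^ n"
      unfolding of_real_power_powr E_def power_mult_distrib[symmetric]
      using q0 by (simp add: powr_diff)
    then have 2: "of_real (q ^ n) powr (N - 1) * of_real q ^ n * of_real (q ^ n) ^ m =
        (E * of_real q ^ m) ^ n"
      by (simp add: power_mult_distrib mult.commute flip: power_mult)
    show ?thesis unfolding 1 W_def[symmetric] 2[symmetric] by (simp add: mult_ac)
  qed
  have Em: "norm (E * of_real q ^ m) < 1"
    using norm_mult_q_power_le[of E m] E1 by linarith
  have eqs: "c * (E * of_real q ^ m) / a = g * of_real q ^ m"
    "c * (E * of_real q ^ m) / b = h * of_real q ^ m"
    "c * (E * of_real q ^ m) / (a * b) = l * of_real q ^ m"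
    unfolding cEa[symmetric] cEb[symmetric] cEab[symmetric] by simp_all
  have lm: "norm (c * (E * of_real q ^ m) / (a * b)) < 1"
    unfolding eqs using norm_mult_q_power_le[of l m] l1 by linarith
  have "((\<lambda>n. qhyp_density (H - L) (G - L) (G - L + H - N) N q (q ^ n) * of_real q ^ n *
        of_real (q ^ n) ^ m) has_sum
      (K * (qi / qpoch_inf c q) * (qpoch_inf (g * of_real q ^ m) q * qpoch_inf (h * of_real q ^ m) q /
       (qpoch_inf (E * of_real q ^ m) q * qpoch_inf (l * of_real q ^ m) q)))) UNIV"
    unfolding dens
    using has_sum_cmult_right[OF q_beta_sum[OF nz(1,2) c1 Em lm]] unfolding eqs .
  also have "K * (qi / qpoch_inf c q) * (qpoch_inf (g * of_real q ^ m) q * qpoch_inf (h * of_real q ^ m) q /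
       (qpoch_inf (E * of_real q ^ m) q * qpoch_inf (l * of_real q ^ m) q)) =
      (K * (qi / qpoch_inf c q) * (qpoch_inf g q * qpoch_inf h q / (qpoch_inf E q * qpoch_inf l q))) *
      (qpoch E q m * qpoch l q m / (qpoch g q m * qpoch h q m))"
  proof -
    have shift: "qpoch_inf (u * of_real q ^ m) q = qpoch_inf u q / qpoch u q m"
      if "qpoch_inf u q \<noteq> 0" for u
      using qpoch_inf_split[of u m] that by (auto simp: field_simps)
    show ?thesis using nzi by (simp add: shift mult_ac)
  qed
  also have "K * (qi / qpoch_inf c q) * (qpoch_inf g q * qpoch_inf h q / (qpoch_inf E q * qpoch_inf l q)) =
      1 / of_real (1 - q)"
  proof -
    define P where "P x = (of_real (1 - q) powr x :: complex)" for x
    have q1: "(of_real (1 - q) :: complex) \<noteq> 0"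
      unfolding of_real_eq_0_iff using q_less_1 by simp
    have P0: "P x \<noteq> 0" for x using q1 by (simp add: P_def)
    \<comment> \<open>The exponents on the left add up to \<open>3 - G - H\<close>, one more than
      those of the two q-Gamma numerators; hence a single power of \<open>1 - q\<close>
      survives.\<close>
    have "P (1 - N) * P (1 - (G - L + H - N)) * P (1 - L) = P (1 - G) * P (1 - H) * P 1"
      unfolding P_def powr_add[symmetric] by (simp add: algebra_simps)
    moreover have "P 1 = of_real (1 - q)" unfolding P_def by (rule powr_to_1)
    ultimately have PP: "P (1 - N) * P (1 - (G - L + H - N)) * P (1 - L) =
        P (1 - G) * P (1 - H) * of_real (1 - q)" by simp
    have "K * (qi / qpoch_inf c q) * (qpoch_inf g q * qpoch_inf h q / (qpoch_inf E q * qpoch_inf l q)) =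
       (P (1 - G) * P (1 - H)) / (P (1 - N) * P (1 - (G - L + H - N)) * P (1 - L))"
      unfolding K_def qGamma_def P_def[symmetric] g_def[symmetric] h_def[symmetric] l_def[symmetric]
        c_def[symmetric] E_def[symmetric] qi_def[symmetric]
      using nzi P0 by (simp add: field_simps)
    also have "\<dots> = 1 / of_real (1 - q)"
      unfolding PP using P0 by simp
    finally show ?thesis .
  qed
  finally show ?thesis
    by (simp add: E_def l_def g_def h_def mult.commute)
qed

end

section \<open>Bounds for products of shifted factorials\<close>

lemma qpochs_bounded:
  assumes "0 < q" "q < 1"
  shows "\<exists>C>0. \<forall>n. norm (qpochs as q n) \<le> C"
proof (induction as)
  case (Cons a as)
  then obtain C where C: "C > 0" "\<And>n. norm (qpochs as q n) \<le> C" by blast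
  obtain D where D: "\<And>n. norm (qpoch a q n) \<le> D" "D > 0"
    using qpoch_bounded[OF assms, of a] by blast
  have "norm (qpochs (a # as) q n) \<le> D * C" for n
    using C D by (auto simp: qpochs_def norm_mult intro!: mult_mono)
  then show ?case using C D by (intro exI[of _ "D * C"]) auto
qed (auto simp: qpochs_def intro: exI[of _ 1])

lemma inverse_qpochs_bounded:
  assumes "0 < q" "q < 1" and "\<And>b j. b \<in> set bs \<Longrightarrow> b * of_real q ^ j \<noteq> 1"
  shows "\<exists>C>0. \<forall>n. norm (inverse (qpochs bs q n)) \<le> C"
  using assms(3)
proof (induction bs)
  case (Cons b bs)
  then obtain C where C: "C > 0" "\<And>n. norm (inverse (qpochs bs q n)) \<le> C"
    by (metis list.set_intros(2))
  obtain D where D: "\<And>n. norm (inverse (qpoch b q n)) \<le> D" "D > 0"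
    using inverse_qpoch_bounded[OF assms(1,2), of b] Cons.prems by (metis list.set_intros(1))
  have "norm (inverse (qpochs (b # bs) q n)) \<le> D * C" for n
  proof -
    have "norm (inverse (qpochs (b # bs) q n)) =
        norm (inverse (qpoch b q n)) * norm (inverse (qpochs bs q n))"
      by (simp add: qpochs_def norm_mult norm_inverse)
    also have "\<dots> \<le> D * C" using C D by (intro mult_mono) auto
    finally show ?thesis .
  qed
  then show ?case using C D by (intro exI[of _ "D * C"]) auto
qed (auto simp: qpochs_def intro: exI[of _ 1])

text \<open>Gives the uniform bounds on series coefficients on which termwise integration
  rests.\<close>

lemma qpochs_quotient_bounded:
  assumes "0 < q" "q < 1" and "\<And>b j. b \<in> set bs \<Longrightarrow> b * of_real q ^ j \<noteq> 1"
  obtains C where "C > 0" "\<And>n. norm (qpochs as q n / qpochs bs q n) \<le> C"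
proof -
  obtain C where C: "C > 0" "\<And>n. norm (qpochs as q n) \<le> C"
    using qpochs_bounded[OF assms(1,2)] by blast
  obtain D where D: "D > 0" "\<And>n. norm (inverse (qpochs bs q n)) \<le> D"
    using inverse_qpochs_bounded[OF assms] by blast
  have "norm (qpochs as q n / qpochs bs q n) \<le> C * D" for n
    unfolding divide_inverse norm_mult by (intro mult_mono C D) (use C in auto)
  then show ?thesis using C D that[of "C * D"] by auto
qed

section \<open>The three-dimensional q-integral\<close>

text \<open>Index functions on \<open>{1..3}\<close> correspond bijectively to triples, the form in
  which the product sums and \<open>Phi_K\<close> are written.\<close>

lemma qintegral_3:
  "qintegral q 3 f = of_real (1 - q) ^ 3 * (\<Sum>\<^sub>\<infinity>(a, b, c)\<in>UNIV.
     f (\<lambda>i\<in>{1..3}. q ^ (if i = 1 then a else if i = 2 then b else c)) *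
     (of_real q ^ a * of_real q ^ b * of_real q ^ c))"
proof -
  have set3: "{1..3} = {1, 2, 3 :: nat}" by auto
  have sum3: "(\<Sum>i=1..3. n i) = n 1 + n 2 + n 3" for n :: "nat \<Rightarrow> nat"
    unfolding set3 by simp
  have "(\<Sum>\<^sub>\<infinity>n\<in>{1..3} \<rightarrow>\<^sub>E (UNIV :: nat set).
        f (\<lambda>i\<in>{1..3}. q ^ n i) * of_real q ^ (\<Sum>i=1..3. n i)) =
     (\<Sum>\<^sub>\<infinity>(a, b, c)\<in>UNIV.
     f (\<lambda>i\<in>{1..3}. q ^ (if i = 1 then a else if i = 2 then b else c)) *
     (of_real q ^ a * of_real q ^ b * of_real q ^ c))"
  proof (rule infsum_reindex_bij_witness[where j = "\<lambda>n. (n 1, n 2, n 3)" and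
        i = "\<lambda>(a, b, c). \<lambda>i\<in>{1..3}. if i = 1 then a else if i = 2 then b else c"])
    fix n :: "nat \<Rightarrow> nat" assume n: "n \<in> {1..3} \<rightarrow>\<^sub>E UNIV"
    have eq: "(if i = 1 then n 1 else if i = 2 then n 2 else n 3) = n i" if "i \<in> {1..3}" for i
      using that unfolding set3 by auto
    show "(case (n 1, n 2, n 3) of (a, b, c) \<Rightarrow>
        \<lambda>i\<in>{1..3}. if i = 1 then a else if i = 2 then b else c) = n"
      unfolding prod.case using n by (intro extensionalityI[where A = "{1..3}"])
        (simp_all only: restrict_extensional PiE_iff restrict_apply' eq)
    have "(\<lambda>i\<in>{1..3}. q ^ (if i = 1 then n 1 else if i = 2 then n 2 else n 3)) =
        (\<lambda>i\<in>{1..3}. q ^ n i)"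
      by (rule restrict_ext) (simp only: eq)
    then show "(case (n 1, n 2, n 3) of (a, b, c) \<Rightarrow>
        f (\<lambda>i\<in>{1..3}. q ^ (if i = 1 then a else if i = 2 then b else c)) *
        (of_real q ^ a * of_real q ^ b * of_real q ^ c)) =
        f (\<lambda>i\<in>{1..3}. q ^ n i) * of_real q ^ (\<Sum>i=1..3. n i)"
      by (simp only: prod.case sum3 power_add)
  qed auto
  then show ?thesis unfolding qintegral_def by simp
qed

section \<open>Termwise integration of the triple series\<close>

theorem corollary4p3:
  fixes q :: real and x y z :: complex
    and \<alpha>1 \<alpha>2 \<beta>1 \<beta>2 :: complex
    and \<gamma> \<eta> lam \<nu> :: "nat \<Rightarrow> complex"
  assumes "0 < q" "q < 1"
    and "norm x < 1" "norm y < 1" "norm z < 1"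
    and "\<And>i. i \<in> {1..3} \<Longrightarrow>
           Min {Re (\<gamma> i + \<eta> i - lam i - \<nu> i), Re (lam i), Re (\<nu> i)} > 0"
    and "\<And>i. i \<in> {1..3} \<Longrightarrow> of_real q powr \<gamma> i \<notin> {of_real q powi (- int n) |n. True}"
    and "\<And>i. i \<in> {1..3} \<Longrightarrow> of_real q powr \<eta> i \<notin> {of_real q powi (- int n) |n. True}"
  shows "Phi_K \<alpha>1 \<alpha>2 \<beta>1 \<beta>2 (\<gamma> 1) (\<gamma> 2) (\<gamma> 3) q x y z =
    qintegral q 3 (\<lambda>t.
      (\<Sum>\<^sub>\<infinity>(m, n, p)\<in>UNIV.
         qpoch (of_real q powr \<alpha>2) q (n + p) * qpoch (of_real q powr \<beta>1) q (p + m) *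
         (qpochs [of_real q powr \<alpha>1, of_real q powr \<eta> 1] q m /
          qpochs [of_real q powr \<nu> 1, of_real q powr lam 1, of_real q] q m) *
         (qpochs [of_real q powr \<beta>2, of_real q powr \<eta> 2] q n /
          qpochs [of_real q powr \<nu> 2, of_real q powr lam 2, of_real q] q n) *
         (qpochs [of_real q powr \<eta> 3] q p /
          qpochs [of_real q powr \<nu> 3, of_real q powr lam 3, of_real q] q p) *
         (x * of_real (t 1)) ^ m * (y * of_real (t 2)) ^ n * (z * of_real (t 3)) ^ p) *
      (\<Prod>j=1..3. qhyp_density (\<eta> j - lam j) (\<gamma> j - lam j) (\<gamma> j - lam j + \<eta> j - \<nu> j) (\<nu> j) q (t j)))"
proof -
  note q = assms(1,2)
  define Q where "Q z = (of_real q powr z :: complex)" for z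
  have pos: "Re (\<gamma> i + \<eta> i - lam i - \<nu> i) > 0" "Re (lam i) > 0" "Re (\<nu> i) > 0"
    if "i \<in> {1..3}" for i using assms(6)[OF that] by simp_all
  have nonres: "u * of_real q ^ j \<noteq> 1" if "u \<notin> {of_real q powi (- int n) |n. True}"
    for u :: complex and j
  proof
    assume "u * of_real q ^ j = 1"
    then have "u = of_real q powi (- int j)"
      using q by (simp add: power_int_minus field_simps)
    then show False using that by blast
  qed
  have \<gamma>_nz: "Q (\<gamma> i) * of_real q ^ j \<noteq> 1" and \<eta>_nz: "Q (\<eta> i) * of_real q ^ j \<noteq> 1"
    if "i \<in> {1..3}" for i j
    unfolding Q_def by (rule nonres, rule assms(7,8)[OF that])+
  \<comment> \<open>Positive real parts give modulus below 1, so no factor can vanish.\<close>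
  have \<nu>_nz: "Q (\<nu> i) * of_real q ^ j \<noteq> 1" and lam_nz: "Q (lam i) * of_real q ^ j \<noteq> 1"
    if "i \<in> {1..3}" for i j
    unfolding Q_def using pos[OF that] by (auto intro!: mult_q_power_neq_1[OF q] norm_q_powr_less_1[OF q])
  note qq_nz = of_real_q_neq_1[OF q]

  \<comment> \<open>\<open>d\<close> includes the weight \<open>q ^ n\<close> but not the factor
    \<open>1 - q\<close> of the q-integral; accordingly the moments \<open>M\<close> carry
    \<open>1 / (1 - q)\<close>.\<close>
  define d where "d i n = qhyp_density (\<eta> i - lam i) (\<gamma> i - lam i) (\<gamma> i - lam i + \<eta> i - \<nu> i)
      (\<nu> i) q (q ^ n) * of_real q ^ n" for i n
  define M where "M i m = qpoch (Q (\<nu> i)) q m * qpoch (Q (lam i)) q m /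
      (qpoch (Q (\<gamma> i)) q m * qpoch (Q (\<eta> i)) q m) / of_real (1 - q)" for i m
  have moment: "((\<lambda>n. d i n * of_real (q ^ n) ^ m) has_sum M i m) UNIV" if i: "i \<in> {1..3}" for i m
    unfolding d_def M_def Q_def
    by (rule qhyp_density_moment[OF q pos[OF i] \<gamma>_nz[OF i, unfolded Q_def] \<eta>_nz[OF i, unfolded Q_def]])
  have d_sum: "(d i has_sum M i 0) UNIV" if "i \<in> {1..3}" for i
    using moment[OF that, of 0] by simp

  define f1 where "f1 m = qpochs [Q \<alpha>1, Q (\<eta> 1)] q m / qpochs [Q (\<nu> 1), Q (lam 1), of_real q] q m" for m
  define f2 where "f2 n = qpochs [Q \<beta>2, Q (\<eta> 2)] q n / qpochs [Q (\<nu> 2), Q (lam 2), of_real q] q n" for n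
  define f3 where "f3 p = qpochs [Q (\<eta> 3)] q p / qpochs [Q (\<nu> 3), Q (lam 3), of_real q] q p" for p
  define A where "A m n p = qpoch (Q \<alpha>2) q (n + p) * qpoch (Q \<beta>1) q (p + m) * f1 m * f2 n * f3 p"
    for m n p
  obtain CA where CA: "\<And>m n p. norm (A m n p) \<le> CA"
  proof -
    obtain X where X: "\<And>n. norm (qpoch (Q \<alpha>2) q n) \<le> X" "X > 0"
      using qpoch_bounded[OF q, of "Q \<alpha>2"] by blast
    obtain Y where Y: "\<And>n. norm (qpoch (Q \<beta>1) q n) \<le> Y" "Y > 0"
      using qpoch_bounded[OF q, of "Q \<beta>1"] by blast
    have den: "b * of_real q ^ j \<noteq> 1"
      if "b \<in> set [Q (\<nu> i), Q (lam i), of_real q]" "i \<in> {1..3}" for b i j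
      using that \<nu>_nz lam_nz qq_nz by auto
    obtain D1 where D1: "D1 > 0" "\<And>n. norm (f1 n) \<le> D1"
      unfolding f1_def by (rule qpochs_quotient_bounded[OF q den[where i = 1]]) auto
    obtain D2 where D2: "D2 > 0" "\<And>n. norm (f2 n) \<le> D2"
      unfolding f2_def by (rule qpochs_quotient_bounded[OF q den[where i = 2]]) auto
    obtain D3 where D3: "D3 > 0" "\<And>n. norm (f3 n) \<le> D3"
      unfolding f3_def by (rule qpochs_quotient_bounded[OF q den[where i = 3]]) auto
    have "norm (A m n p) \<le> X * Y * D1 * D2 * D3" for m n p
      unfolding A_def norm_mult
      by (intro mult_mono X Y D1 D2 D3 mult_nonneg_nonneg norm_ge_zero) (use X Y D1 D2 D3 in auto)
    then show ?thesis using that by blast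
  qed

  \<comment> \<open>One family over the integration points \<open>(a, b, c)\<close> and the series
    indices \<open>(m, n, p)\<close>; exchanging its two summations is the termwise
    integration.\<close>
  define F where "F = (\<lambda>(a, b, c) (m, n, p). d 1 a * (d 2 b * d 3 c) *
      (A m n p * (x * of_real (q ^ a)) ^ m * (y * of_real (q ^ b)) ^ n * (z * of_real (q ^ c)) ^ p))"
  have F_summable: "(\<lambda>(r, s). F r s) summable_on UNIV \<times> UNIV"
  proof (rule summable_on_comparison_complex)
    \<comment> \<open>The majorant omits \<open>A\<close>, bounded by \<open>CA\<close>, and the
      powers of \<open>q\<close> attached to \<open>x\<close>, \<open>y\<close>, \<open>z\<close>.
      It is a product of six summable families: three masses, summable by the zeroth moments, and
      three geometric series.\<close>
    define g where "g = (\<lambda>((a, b, c), (m, n, p)). (d 1 a * (d 2 b * d 3 c)) * (x ^ m * (y ^ n * z ^ p)))"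
    have i: "1 \<in> {1..3::nat}" "2 \<in> {1..3::nat}" "3 \<in> {1..3::nat}" by auto
    note has_sum_Times[OF
        has_sum_Times[OF d_sum[OF i(1)] has_sum_Times[OF d_sum[OF i(2)] d_sum[OF i(3)]]]
        has_sum_Times[OF geometric_has_sum[OF assms(3)]
          has_sum_Times[OF geometric_has_sum[OF assms(4)] geometric_has_sum[OF assms(5)]]]]
    then show "g summable_on UNIV \<times> UNIV"
      by (auto simp: g_def case_prod_unfold dest: has_sum_imp_summable)
    fix rs :: "(nat \<times> nat \<times> nat) \<times> (nat \<times> nat \<times> nat)"
    obtain a b c m n p where rs: "rs = ((a, b, c), (m, n, p))" by (metis surj_pair)
    define D where "D = d 1 a * (d 2 b * d 3 c)"
    have "norm (F (a, b, c) (m, n, p)) = norm D * (norm (A m n p) *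
        (norm (x * of_real q ^ a) ^ m * (norm (y * of_real q ^ b) ^ n * norm (z * of_real q ^ c) ^ p)))"
      by (simp add: F_def D_def norm_mult norm_power mult_ac)
    also have "\<dots> \<le> norm D * (CA * (norm x ^ m * (norm y ^ n * norm z ^ p)))"
      by (intro mult_left_mono mult_mono CA power_mono norm_mult_q_power_le[OF q]
          mult_nonneg_nonneg zero_le_power norm_ge_zero order_trans[OF norm_ge_zero CA])
    finally show "norm (case rs of (r, s) \<Rightarrow> F r s) \<le> CA * norm (g rs)"
      by (simp add: rs g_def D_def norm_mult norm_power mult_ac)
  qed

  \<comment> \<open>For fixed series indices the sum over the points factors into three
    one-dimensional moments.\<close>
  have inner: "(\<Sum>\<^sub>\<infinity>r. F r (m, n, p)) = A m n p * (x ^ m * y ^ n * z ^ p) * (M 1 m * (M 2 n * M 3 p))"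
    for m n p
  proof (rule infsumI)
    have "((\<lambda>(a, r). (d 1 a * of_real (q ^ a) ^ m) * (case r of (b, c) \<Rightarrow>
        (d 2 b * of_real (q ^ b) ^ n) * (d 3 c * of_real (q ^ c) ^ p))) has_sum (M 1 m * (M 2 n * M 3 p)))
        (UNIV \<times> (UNIV \<times> UNIV))"
      by (intro has_sum_Times moment) auto
    from has_sum_cmult_right[OF this, of "A m n p * (x ^ m * y ^ n * z ^ p)"]
    show "((\<lambda>r. F r (m, n, p)) has_sum (A m n p * (x ^ m * y ^ n * z ^ p) * (M 1 m * (M 2 n * M 3 p)))) UNIV"
      by (simp add: F_def case_prod_unfold power_mult_distrib mult_ac)
  qed

  define t where "t a b c = (\<lambda>i\<in>{1..3::nat}. q ^ (if i = 1 then a else if i = 2 then b else c))"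
    for a b c :: nat
  have t: "t a b c 1 = q ^ a" "t a b c 2 = q ^ b" "t a b c 3 = q ^ c" for a b c
    by (simp_all add: t_def)
  have "{1..3} = {1, 2, 3 :: nat}" by auto
  then have prod3: "(\<Prod>j=1..3. f j) = f 1 * (f 2 * f 3)" for f :: "nat \<Rightarrow> complex"
    by simp
  have "qintegral q 3 (\<lambda>t. (\<Sum>\<^sub>\<infinity>(m, n, p)\<in>UNIV. A m n p *
         (x * of_real (t 1)) ^ m * (y * of_real (t 2)) ^ n * (z * of_real (t 3)) ^ p) *
      (\<Prod>j=1..3. qhyp_density (\<eta> j - lam j) (\<gamma> j - lam j) (\<gamma> j - lam j + \<eta> j - \<nu> j) (\<nu> j) q (t j))) =
    of_real (1 - q) ^ 3 * (\<Sum>\<^sub>\<infinity>r. \<Sum>\<^sub>\<infinity>s. F r s)"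
  proof -
    have F_eq: "(\<Sum>\<^sub>\<infinity>s. F (a, b, c) s) = d 1 a * (d 2 b * d 3 c) * (\<Sum>\<^sub>\<infinity>(m, n, p)\<in>UNIV. A m n p *
         (x * of_real (q ^ a)) ^ m * (y * of_real (q ^ b)) ^ n * (z * of_real (q ^ c)) ^ p)" for a b c
      unfolding F_def prod.case
      by (subst infsum_cmult_right'[symmetric]) (simp add: case_prod_unfold)
    show ?thesis
      unfolding qintegral_3 t_def[symmetric]
    proof (intro arg_cong2[where f = "(*)"] infsum_cong refl)
      fix r :: "nat \<times> nat \<times> nat"
      obtain a b c where r: "r = (a, b, c)" by (metis surj_pair)
      show "(case r of (a, b, c) \<Rightarrow> (\<Sum>\<^sub>\<infinity>(m, n, p)\<in>UNIV. A m n p *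
           (x * of_real (t a b c 1)) ^ m * (y * of_real (t a b c 2)) ^ n * (z * of_real (t a b c 3)) ^ p) *
        (\<Prod>j=1..3. qhyp_density (\<eta> j - lam j) (\<gamma> j - lam j) (\<gamma> j - lam j + \<eta> j - \<nu> j) (\<nu> j) q
           (t a b c j)) * (of_real q ^ a * of_real q ^ b * of_real q ^ c)) = (\<Sum>\<^sub>\<infinity>s. F r s)"
        unfolding r F_eq prod.case t prod3 d_def by (simp only: mult_ac)
    qed
  qed
  also have "(\<Sum>\<^sub>\<infinity>r. \<Sum>\<^sub>\<infinity>s. F r s) = (\<Sum>\<^sub>\<infinity>s. \<Sum>\<^sub>\<infinity>r. F r s)"
    by (rule infsum_swap_banach[OF F_summable])
  also have "of_real (1 - q) ^ 3 * \<dots> = (\<Sum>\<^sub>\<infinity>s. of_real (1 - q) ^ 3 * (\<Sum>\<^sub>\<infinity>r. F r s))"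
    by (rule infsum_cmult_right'[symmetric])
  also have "\<dots> = Phi_K \<alpha>1 \<alpha>2 \<beta>1 \<beta>2 (\<gamma> 1) (\<gamma> 2) (\<gamma> 3) q x y z"
    unfolding Phi_K_def Q_def[symmetric]
  proof (rule infsum_cong)
    fix s :: "nat \<times> nat \<times> nat"
    obtain m n p where s: "s = (m, n, p)" by (metis surj_pair)
    have q1: "(of_real (1 - q) :: complex) \<noteq> 0"
      unfolding of_real_eq_0_iff using q by simp
    have nz: "qpoch (Q (\<eta> i)) q k \<noteq> 0" "qpoch (Q (\<gamma> i)) q k \<noteq> 0" "qpoch (Q (\<nu> i)) q k \<noteq> 0"
      "qpoch (Q (lam i)) q k \<noteq> 0" if "i \<in> {1..3}" for i k
      using that by (auto intro!: qpoch_nonzero \<eta>_nz \<gamma>_nz \<nu>_nz lam_nz)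
    \<comment> \<open>Each of the three factors \<open>1 - q\<close> in front of the q-integral is
      given to one moment, where it cancels the denominator.\<close>
    define e :: complex where "e = of_real (1 - q)"
    have M: "e * M i k = qpoch (Q (\<nu> i)) q k * qpoch (Q (lam i)) q k /
      (qpoch (Q (\<gamma> i)) q k * qpoch (Q (\<eta> i)) q k)" for i k
      using q1 by (simp add: M_def e_def)
    \<comment> \<open>The moment cancels the \<nu>, \<open>lam\<close> and \<eta> factorials of the
      coefficient and brings the \<gamma> factorial into the denominator.\<close>
    have g1: "f1 m * (e * M 1 m) = qpoch (Q \<alpha>1) q m / qpochs [Q (\<gamma> 1), of_real q] q m"
      unfolding M f1_def qpochs_def using nz[of 1 m] by simp
    have g2: "f2 n * (e * M 2 n) = qpoch (Q \<beta>2) q n / qpochs [Q (\<gamma> 2), of_real q] q n"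
      unfolding M f2_def qpochs_def using nz[of 2 n] by simp
    have g3: "f3 p * (e * M 3 p) = 1 / qpochs [Q (\<gamma> 3), of_real q] q p"
      unfolding M f3_def qpochs_def using nz[of 3 p] by simp
    have "e ^ 3 * (\<Sum>\<^sub>\<infinity>r. F r s) = qpoch (Q \<alpha>2) q (n + p) * qpoch (Q \<beta>1) q (m + p) *
        (x ^ m * y ^ n * z ^ p) * (f1 m * (e * M 1 m)) * (f2 n * (e * M 2 n)) * (f3 p * (e * M 3 p))"
      unfolding s inner A_def by (simp add: power3_eq_cube add.commute mult_ac)
    also have "\<dots> = (case s of (m, n, p) \<Rightarrow> qpoch (Q \<alpha>1) q m * qpoch (Q \<alpha>2) q (n + p) *
        qpoch (Q \<beta>1) q (m + p) * qpoch (Q \<beta>2) q n /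
        (qpochs [Q (\<gamma> 1), of_real q] q m * qpochs [Q (\<gamma> 2), of_real q] q n *
         qpochs [Q (\<gamma> 3), of_real q] q p) * x ^ m * y ^ n * z ^ p)"
      unfolding g1 g2 g3 s by (simp add: mult_ac)
    finally show "of_real (1 - q) ^ 3 * (\<Sum>\<^sub>\<infinity>r. F r s) =
      (case s of (m, n, p) \<Rightarrow> qpoch (Q \<alpha>1) q m * qpoch (Q \<alpha>2) q (n + p) *
        qpoch (Q \<beta>1) q (m + p) * qpoch (Q \<beta>2) q n /
        (qpochs [Q (\<gamma> 1), of_real q] q m * qpochs [Q (\<gamma> 2), of_real q] q n *
         qpochs [Q (\<gamma> 3), of_real q] q p) * x ^ m * y ^ n * z ^ p)"
      unfolding e_def .
  qed
  finally show ?thesis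
    unfolding A_def f1_def f2_def f3_def Q_def by (rule sym)
qed

end
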